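(* Let $\bar\gamma>0$, and let $\gamma$ be the instantaneous SNR of the normalized SOSF fading channel with parameters $(\alpha,\beta)$ and average SNR $\bar\gamma$. Its moment generating function $\mathcal{M}_\gamma(s)=\mathbb{E}(e^{s\gamma})$, for real $s<0$, is given in the following special cases by: (i) (Double-Rayleigh and LOS.) If $0<\alpha\le1$ and $\beta=1-\alpha$, $$\mathcal{M}_\gamma(s)=-\frac{e^{-\frac{1}{s\bar\gamma \alpha}}}{s\bar \gamma \alpha}\, \Gamma \!\left(0,\frac{-1}{s\alpha\bar \gamma},\frac{1-\alpha}{\alpha}\right).$$ (ii) (Rayleigh and double-Rayleigh.) If $0<\alpha\le1$ and $\beta=0$, $$\mathcal{M}_\gamma(s)=-\frac{1}{s\bar \gamma \alpha}\exp\!\left(\frac{s\bar \gamma(1-\alpha)-1}{s\bar \gamma \alpha}\right)E_1\!\left( \frac{s(1-\alpha)\bar \gamma-1}{s\bar \gamma \alpha}\right).$$ (iii) (Double-Rayleigh.) If $\alpha=1$ and $\beta=0$, $$\mathcal{M}_\gamma(s)=-\frac{e^{-\frac{1}{s\bar \gamma}}}{s\bar \gamma}\,E_1\!\left( \frac{-1}{s\bar \gamma}\right).$$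
   Context: SOSF (second order scattering fading) channel: $S=\omega_0e^{j\phi}+\omega_1G_1+\omega_2G_2G_3$, where $j$ is the imaginary unit, $\omega_0,\omega_1,\omega_2\ge 0$ are real constants with $\omega_0^2+\omega_1^2+\omega_2^2=1$, $\phi$ is uniform on $[0,2\pi)$, and $G_1,G_2,G_3$ are circularly-symmetric complex Gaussian random variables with mean $0$ and variance $\mathbb{E}|G_i|^2=1$; $\phi,G_1,G_2,G_3$ are mutually independent. The parameters are $\alpha=\omega_2^2$ and $\beta=\omega_0^2$ (so $\omega_1^2=1-\alpha-\beta$). The instantaneous SNR is $\gamma=\bar\gamma|S|^2$, so that $\mathbb{E}(\gamma)=\bar\gamma$. The generalized incomplete gamma function is $\Gamma(a,x,b)=\int_{x}^{\infty}t^{a-1} e^{-t}e^{-b/t}\,dt$, and $E_1(x)=\int_x^\infty\frac{e^{-z}}{z}\,dz$ for $x>0$ is the exponential integral. *)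

theory Defs
  imports "HOL-Probability.Probability"
begin

definition circular_complex_gaussian :: "'a measure \<Rightarrow> real \<Rightarrow> ('a \<Rightarrow> complex) \<Rightarrow> bool" where
  "circular_complex_gaussian M v Z \<longleftrightarrow>
     distributed M lborel (\<lambda>x. Re (Z x)) (\<lambda>t. ennreal (normal_density 0 (sqrt (v / 2)) t)) \<and>
     distributed M lborel (\<lambda>x. Im (Z x)) (\<lambda>t. ennreal (normal_density 0 (sqrt (v / 2)) t)) \<and>
     prob_space.indep_var M borel (\<lambda>x. Re (Z x)) borel (\<lambda>x. Im (Z x))"
  \<comment> \<open>The second argument of \<open>normal_density\<close> is the standard deviation. Each component has
      variance \<open>v / 2\<close>, so that \<open>E |Z|^2 = v\<close>.\<close>

text \<open>
  Mutual independence is stated for the generated sigma-algebras, as \<open>indep_vars\<close> requires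
  all variables to have the same range type, while \<open>\<phi>\<close> is real and the \<open>G\<close>'s are complex.
\<close>

locale sosf_channel = prob_space M for M :: "'a measure" +
  fixes \<omega>0 \<omega>1 \<omega>2 :: real
    and \<phi> :: "'a \<Rightarrow> real"
    and G1 G2 G3 :: "'a \<Rightarrow> complex"
  assumes weights_nonneg: "0 \<le> \<omega>0" "0 \<le> \<omega>1" "0 \<le> \<omega>2"
    and weights_normalized: "\<omega>0\<^sup>2 + \<omega>1\<^sup>2 + \<omega>2\<^sup>2 = 1"
    and phase_measurable: "random_variable borel \<phi>"
    and phase_uniform: "distr M lborel \<phi> = uniform_measure lborel {0..<2 * pi}"
    and gauss_measurable: "random_variable borel G1" "random_variable borel G2"
      "random_variable borel G3"
    and gauss: "circular_complex_gaussian M 1 G1" "circular_complex_gaussian M 1 G2"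
      "circular_complex_gaussian M 1 G3"
    and mutually_indep:
      "indep_sets (\<lambda>i. [sets (vimage_algebra (space M) \<phi> borel),
                        sets (vimage_algebra (space M) G1 borel),
                        sets (vimage_algebra (space M) G2 borel),
                        sets (vimage_algebra (space M) G3 borel)] ! i) {..<4::nat}"

definition sosf_signal ::
  "real \<Rightarrow> real \<Rightarrow> real \<Rightarrow> ('a \<Rightarrow> real) \<Rightarrow> ('a \<Rightarrow> complex) \<Rightarrow> ('a \<Rightarrow> complex) \<Rightarrow> ('a \<Rightarrow> complex)
     \<Rightarrow> 'a \<Rightarrow> complex" where
  "sosf_signal \<omega>0 \<omega>1 \<omega>2 \<phi> G1 G2 G3 x =
     of_real \<omega>0 * exp (\<i> * of_real (\<phi> x)) + of_real \<omega>1 * G1 x + of_real \<omega>2 * G2 x * G3 x"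

definition inst_snr :: "real \<Rightarrow> ('a \<Rightarrow> complex) \<Rightarrow> 'a \<Rightarrow> real" where
  "inst_snr gbar S x = gbar * (cmod (S x))\<^sup>2"

definition mgf :: "'a measure \<Rightarrow> ('a \<Rightarrow> real) \<Rightarrow> real \<Rightarrow> real" where
  "mgf M X s = (\<integral>x. exp (s * X x) \<partial>M)"

definition gen_inc_Gamma :: "real \<Rightarrow> real \<Rightarrow> real \<Rightarrow> real" where
  "gen_inc_Gamma a x b = (LINT t:{x..}|lborel. t powr (a - 1) * exp (- t) * exp (- b / t))"

definition exp_integral_E1 :: "real \<Rightarrow> real" where
  "exp_integral_E1 x = (LINT z:{x..}|lborel. exp (- z) / z)"

end

(* For k > 0 and a standard complex Gaussian Z, completing the square gives
   E exp (-k |m + c Z|^2) = exp (-k |m|^2 / D) / D  with  D = 1 + k |c|^2.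
   Integrating out G1 and then G2 by this formula removes the phase and leaves the expectation of
   exp (-k w0^2 / D) / D  with  D = 1 + k w1^2 + k w2^2 R,  where R = |G3|^2 is exponential with
   mean 1. In terms of t = D / (k w2^2) this is an incomplete gamma integral for all parameters,
   and all three cases are specialisations of it. *)
theory Submission
  imports Defs
begin

section \<open>Nonnegative integrals on the line and in the plane\<close>

lemma nn_integral_even:
  fixes f :: "real \<Rightarrow> ennreal"
  assumes [measurable]: "f \<in> borel_measurable borel" and even: "\<And>x. f (- x) = f x"
  shows "(\<integral>\<^sup>+x. f x \<partial>lborel) = 2 * (\<integral>\<^sup>+x. f x * indicator {0..} x \<partial>lborel)"
proof -
  have "(\<integral>\<^sup>+x. f x \<partial>lborel)
      = (\<integral>\<^sup>+x. f x * indicator {0..} x + f x * indicator {..0} x \<partial>lborel)"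
    by (intro nn_integral_cong_AE AE_I[where N="{0}"]) (auto split: split_indicator_asm)
  also have "\<dots> = (\<integral>\<^sup>+x. f x * indicator {0..} x \<partial>lborel)
      + (\<integral>\<^sup>+x. f x * indicator {..0} x \<partial>lborel)"
    by (rule nn_integral_add) auto
  also have "(\<integral>\<^sup>+x. f x * indicator {..0} x \<partial>lborel)
      = (\<integral>\<^sup>+x. f x * indicator {0..} x \<partial>lborel)"
    by (subst nn_integral_real_affine[where c="-1" and t=0])
      (auto simp: even intro!: nn_integral_cong split: split_indicator)
  finally show ?thesis by (simp add: mult_2)
qed

text \<open>With s = tan \<theta> one has d\<theta> = ds / (1 + s^2), so this is the total angle
  swept by lines through the origin. It is a half turn rather than a full one because the radius
  that goes with it is signed.\<close>

lemma nn_integral_inverse_1_plus_square: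
  "(\<integral>\<^sup>+s. ennreal (1 / (1 + s\<^sup>2)) \<partial>lborel) = ennreal pi"
proof -
  have "(\<integral>\<^sup>+s. ennreal (1 / (1 + s\<^sup>2)) * indicator {0..} s \<partial>lborel) = ennreal (pi / 2 - arctan 0)"
    by (rule nn_integral_FTC_atLeast)
      (auto intro!: derivative_eq_intros tendsto_arctan_at_top simp: field_simps)
  moreover have "(\<integral>\<^sup>+s. ennreal (1 / (1 + s\<^sup>2)) \<partial>lborel)
      = 2 * (\<integral>\<^sup>+s. ennreal (1 / (1 + s\<^sup>2)) * indicator {0..} s \<partial>lborel)"
    by (rule nn_integral_even) auto
  moreover have "2 * ennreal (pi / 2 - arctan 0) = ennreal pi"
    using ennreal_mult'[of 2 "pi / 2"] by simp
  ultimately show ?thesis by simp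
qed

text \<open>Polar coordinates with the slope \<open>y / x\<close> in place of the angle.\<close>

lemma nn_integral_radial_plane:
  fixes g :: "real \<Rightarrow> ennreal"
  assumes [measurable]: "g \<in> borel_measurable borel"
  shows "(\<integral>\<^sup>+x. \<integral>\<^sup>+y. g (x\<^sup>2 + y\<^sup>2) \<partial>lborel \<partial>lborel) = pi * (\<integral>\<^sup>+z. ennreal \<bar>z\<bar> * g (z\<^sup>2) \<partial>lborel)"
proof -
  have "(\<integral>\<^sup>+x. \<integral>\<^sup>+y. g (x\<^sup>2 + y\<^sup>2) \<partial>lborel \<partial>lborel)
      = (\<integral>\<^sup>+x. \<integral>\<^sup>+s. ennreal \<bar>x\<bar> * g (x\<^sup>2 * (1 + s\<^sup>2)) \<partial>lborel \<partial>lborel)"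
  \<comment> \<open>The substitution y = x * s has Jacobian |x| and is invertible only for x
    \<noteq> 0; the exceptional point is a null set.\<close>
  proof (intro nn_integral_cong_AE AE_I[where N="{0}"] subsetI)
    fix x :: real
    assume "x \<in> {x \<in> space lborel. (\<integral>\<^sup>+y. g (x\<^sup>2 + y\<^sup>2) \<partial>lborel)
      \<noteq> (\<integral>\<^sup>+s. ennreal \<bar>x\<bar> * g (x\<^sup>2 * (1 + s\<^sup>2)) \<partial>lborel)}"
    moreover have "(\<integral>\<^sup>+y. g (x\<^sup>2 + y\<^sup>2) \<partial>lborel) = (\<integral>\<^sup>+s. ennreal \<bar>x\<bar> * g (x\<^sup>2 * (1 + s\<^sup>2)) \<partial>lborel)"
      if "x \<noteq> 0"
      using that by (subst nn_integral_real_affine[where c=x and t=0])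
        (auto simp: nn_integral_cmult power_mult_distrib algebra_simps)
    ultimately show "x \<in> {0}" by auto
  qed auto
  also have "\<dots> = (\<integral>\<^sup>+s. \<integral>\<^sup>+x. ennreal \<bar>x\<bar> * g (x\<^sup>2 * (1 + s\<^sup>2)) \<partial>lborel \<partial>lborel)"
    by (rule lborel_pair.Fubini'[symmetric]) auto
  also have "\<dots> = (\<integral>\<^sup>+s. ennreal (1 / (1 + s\<^sup>2)) * (\<integral>\<^sup>+z. ennreal \<bar>z\<bar> * g (z\<^sup>2) \<partial>lborel) \<partial>lborel)"
  proof (rule nn_integral_cong)
    fix s :: real
    \<comment> \<open>Rescaling x = z / c turns x^2 * (1 + s^2) into z^2. The weight |x| and the
      Jacobian contribute one factor 1 / c each, which together make the density 1 / (1 + s^2) of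
      the slope.\<close>
    define c where "c = sqrt (1 + s\<^sup>2)"
    have c: "c > 0" "c\<^sup>2 = 1 + s\<^sup>2"
      by (auto simp: c_def add_pos_nonneg)
    have "(\<integral>\<^sup>+x. ennreal \<bar>x\<bar> * g (x\<^sup>2 * (1 + s\<^sup>2)) \<partial>lborel)
        = ennreal \<bar>1 / c\<bar> * (\<integral>\<^sup>+z. ennreal \<bar>0 + 1 / c * z\<bar> * g ((0 + 1 / c * z)\<^sup>2 * (1 + s\<^sup>2)) \<partial>lborel)"
      using c by (intro nn_integral_real_affine) auto
    also have "\<dots> = ennreal (1 / c) * (\<integral>\<^sup>+z. ennreal (1 / c) * (ennreal \<bar>z\<bar> * g (z\<^sup>2)) \<partial>lborel)"
    proof -
      have "ennreal \<bar>0 + 1 / c * z\<bar> * g ((0 + 1 / c * z)\<^sup>2 * (1 + s\<^sup>2))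
          = ennreal (1 / c) * (ennreal \<bar>z\<bar> * g (z\<^sup>2))" for z
        using c(1) ennreal_mult[of "1 / c" "\<bar>z\<bar>"]
        by (simp add: c(2)[symmetric] power_divide mult.assoc)
      then show ?thesis
        using c by simp
    qed
    also have "\<dots> = ennreal (1 / c * (1 / c)) * (\<integral>\<^sup>+z. ennreal \<bar>z\<bar> * g (z\<^sup>2) \<partial>lborel)"
      using c ennreal_mult[of "1 / c" "1 / c"] by (simp add: nn_integral_cmult mult.assoc)
    also have "1 / c * (1 / c) = 1 / (1 + s\<^sup>2)"
      using c(2) by (simp add: power2_eq_square)
    finally show "(\<integral>\<^sup>+x. ennreal \<bar>x\<bar> * g (x\<^sup>2 * (1 + s\<^sup>2)) \<partial>lborel)
        = ennreal (1 / (1 + s\<^sup>2)) * (\<integral>\<^sup>+z. ennreal \<bar>z\<bar> * g (z\<^sup>2) \<partial>lborel)" .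
  qed
  also have "\<dots> = ennreal pi * (\<integral>\<^sup>+z. ennreal \<bar>z\<bar> * g (z\<^sup>2) \<partial>lborel)"
    by (simp add: nn_integral_multc nn_integral_inverse_1_plus_square)
  finally show ?thesis .
qed

text \<open>This is the radial integral behind the distribution function of |Z|^2. On the half-line,
  z * exp (- z^2) has primitive - exp (- z^2) / 2 and the cutoff is at sqrt a; evenness doubles the
  result.\<close>

lemma nn_integral_truncated_gaussian_first_moment:
  assumes "0 \<le> a"
  shows "(\<integral>\<^sup>+z. ennreal \<bar>z\<bar> * ennreal (exp (- z\<^sup>2) * indicator {..a} (z\<^sup>2)) \<partial>lborel) = ennreal (1 - exp (- a))"
proof -
  have "(\<integral>\<^sup>+z. ennreal (z * exp (- z\<^sup>2)) * indicator {0..sqrt a} z \<partial>lborel)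
      = ennreal ((- exp (- (sqrt a)\<^sup>2) / 2) - (- exp (- 0\<^sup>2) / 2))"
    using assms by (intro nn_integral_FTC_Icc) (auto intro!: derivative_eq_intros)
  also have "\<dots> = ennreal ((1 - exp (- a)) / 2)"
    using assms by (simp add: field_simps)
  also have "(\<integral>\<^sup>+z. ennreal (z * exp (- z\<^sup>2)) * indicator {0..sqrt a} z \<partial>lborel)
      = (\<integral>\<^sup>+z. ennreal \<bar>z\<bar> * ennreal (exp (- z\<^sup>2) * indicator {..a} (z\<^sup>2)) * indicator {0..} z \<partial>lborel)"
  proof (rule nn_integral_cong)
    fix z :: real
    have "z\<^sup>2 \<le> a \<longleftrightarrow> z \<le> sqrt a" if "0 \<le> z"
      using that real_sqrt_le_iff[of "z\<^sup>2" a] by simp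
    then show "ennreal (z * exp (- z\<^sup>2)) * indicator {0..sqrt a} z
        = ennreal \<bar>z\<bar> * ennreal (exp (- z\<^sup>2) * indicator {..a} (z\<^sup>2)) * indicator {0..} z"
      by (auto simp: ennreal_mult split: split_indicator)
  qed
  finally have "(\<integral>\<^sup>+z. ennreal \<bar>z\<bar> * ennreal (exp (- z\<^sup>2) * indicator {..a} (z\<^sup>2)) * indicator {0..} z \<partial>lborel)
      = ennreal ((1 - exp (- a)) / 2)" by simp
  moreover have "(\<integral>\<^sup>+z. ennreal \<bar>z\<bar> * ennreal (exp (- z\<^sup>2) * indicator {..a} (z\<^sup>2)) \<partial>lborel)
      = 2 * (\<integral>\<^sup>+z. ennreal \<bar>z\<bar> * ennreal (exp (- z\<^sup>2) * indicator {..a} (z\<^sup>2)) * indicator {0..} z \<partial>lborel)"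
    by (rule nn_integral_even) auto
  moreover have "2 * ennreal ((1 - exp (- a)) / 2) = ennreal (1 - exp (- a))"
  proof -
    define e where "e = (1 - exp (- a)) / 2"
    have "1 - exp (- a) = 2 * e" by (simp add: e_def field_simps)
    then show ?thesis unfolding e_def[symmetric] by (simp add: ennreal_mult')
  qed
  ultimately show ?thesis by simp
qed

text \<open>Completing the square makes the integrand a constant multiple of the normal density with
  mean - b / A and variance 1 / (2 * A), whose total mass is 1.\<close>

lemma nn_integral_gaussian_linear:
  fixes A b :: real
  assumes A: "0 < A"
  shows "(\<integral>\<^sup>+x. ennreal (exp (- A * x\<^sup>2 - 2 * b * x)) \<partial>lborel) = ennreal (sqrt (pi / A) * exp (b\<^sup>2 / A))"
proof -
  define \<sigma> where "\<sigma> = sqrt (1 / (2 * A))"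
  have \<sigma>: "\<sigma> > 0" "\<sigma>\<^sup>2 = 1 / (2 * A)"
    using A by (auto simp: \<sigma>_def)
  have "exp (- A * x\<^sup>2 - 2 * b * x) = sqrt (pi / A) * exp (b\<^sup>2 / A) * normal_density (- b / A) \<sigma> x" for x
  proof -
    have "- A * x\<^sup>2 - 2 * b * x = b\<^sup>2 / A - (x + b / A)\<^sup>2 * A"
      using A by (simp add: field_simps power2_eq_square)
    then have "exp (- A * x\<^sup>2 - 2 * b * x) = exp (b\<^sup>2 / A) * exp (- ((x + b / A)\<^sup>2 * A))"
      by (simp add: mult_exp_exp)
    moreover have "sqrt (pi / A) > 0" using A by simp
    ultimately show ?thesis
      using A by (simp add: normal_density_def \<sigma>)
  qed
  then have "(\<integral>\<^sup>+x. ennreal (exp (- A * x\<^sup>2 - 2 * b * x)) \<partial>lborel)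
      = (\<integral>\<^sup>+x. ennreal (sqrt (pi / A) * exp (b\<^sup>2 / A)) * ennreal (normal_density (- b / A) \<sigma> x) \<partial>lborel)"
    using A by (simp add: ennreal_mult[symmetric])
  also have "\<dots> = ennreal (sqrt (pi / A) * exp (b\<^sup>2 / A)) * (\<integral>\<^sup>+x. ennreal (normal_density (- b / A) \<sigma> x) \<partial>lborel)"
    by (rule nn_integral_cmult) auto
  also have "(\<integral>\<^sup>+x. ennreal (normal_density (- b / A) \<sigma> x) \<partial>lborel) = 1"
    using \<sigma> by (subst nn_integral_eq_integral) auto
  finally show ?thesis by simp
qed

section \<open>Expectations of functions of a standard complex Gaussian, and integration over
  independent variables\<close>

context prob_space
begin

text \<open>Both components have variance 1 / 2, hence density exp (- t^2) / sqrt pi, and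
  independence makes the joint density their product.\<close>

lemma nn_integral_standard_complex_gaussian:
  fixes f :: "complex \<Rightarrow> ennreal"
  assumes Z: "circular_complex_gaussian M 1 Z"
    and f[measurable]: "f \<in> borel_measurable borel"
  shows "(\<integral>\<^sup>+\<omega>. f (Z \<omega>) \<partial>M)
    = ennreal (1 / pi) * (\<integral>\<^sup>+x. \<integral>\<^sup>+y. ennreal (exp (- (x\<^sup>2 + y\<^sup>2))) * f (Complex x y) \<partial>lborel \<partial>lborel)"
proof -
  let ?n = "\<lambda>t. ennreal (normal_density 0 (sqrt (1 / 2)) t)"
  have [measurable]: "(\<lambda>(x, y). Complex x y) \<in> borel_measurable (borel \<Otimes>\<^sub>M borel)"
    by (simp add: Complex_eq case_prod_beta')
  have g: "(\<lambda>(x, y). f (Complex x y)) \<in> borel_measurable (lborel \<Otimes>\<^sub>M lborel)"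
    by measurable
  have n: "normal_density 0 (sqrt (1 / 2)) t = exp (- t\<^sup>2) / sqrt pi" for t
    by (simp add: normal_density_def)
  have "indep_var borel (\<lambda>\<omega>. Re (Z \<omega>)) borel (\<lambda>\<omega>. Im (Z \<omega>))"
    using Z by (simp add: circular_complex_gaussian_def)
  \<comment> \<open>Composing with \<open>id\<close> only changes the target measure from
    \<open>borel\<close> to \<open>lborel\<close>, the reference measure of the two
    densities.\<close>
  from indep_var_compose[OF this, of id lborel id lborel]
  have "indep_var lborel (\<lambda>\<omega>. Re (Z \<omega>)) lborel (\<lambda>\<omega>. Im (Z \<omega>))"
    by (simp add: comp_def)
  then have "distributed M (lborel \<Otimes>\<^sub>M lborel) (\<lambda>\<omega>. (Re (Z \<omega>), Im (Z \<omega>))) (\<lambda>(x, y). ?n x * ?n y)"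
    using Z unfolding circular_complex_gaussian_def
    by (intro distributed_joint_indep sigma_finite_lborel) simp_all
  from distributed_nn_integral[OF this g]
  have "(\<integral>\<^sup>+\<omega>. f (Z \<omega>) \<partial>M)
      = (\<integral>\<^sup>+p. (case p of (x, y) \<Rightarrow> ?n x * ?n y * f (Complex x y)) \<partial>(lborel \<Otimes>\<^sub>M lborel))"
    by (simp add: case_prod_beta')
  also have "\<dots> = (\<integral>\<^sup>+x. \<integral>\<^sup>+y. ?n x * ?n y * f (Complex x y) \<partial>lborel \<partial>lborel)"
    by (subst lborel.nn_integral_fst[symmetric]) auto
  also have "\<dots> = (\<integral>\<^sup>+x. \<integral>\<^sup>+y. ennreal (1 / pi) * (ennreal (exp (- (x\<^sup>2 + y\<^sup>2))) * f (Complex x y)) \<partial>lborel \<partial>lborel)"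
    unfolding n
    by (intro nn_integral_cong)
      (simp add: ennreal_mult[symmetric] mult.assoc[symmetric] mult_exp_exp divide_simps)
  also have "\<dots> = ennreal (1 / pi) * (\<integral>\<^sup>+x. \<integral>\<^sup>+y. ennreal (exp (- (x\<^sup>2 + y\<^sup>2))) * f (Complex x y) \<partial>lborel \<partial>lborel)"
    by (simp add: nn_integral_cmult)
  finally show ?thesis .
qed

text \<open>The joint density depends on the radius alone, so the probability of a disc reduces to
  the truncated radial integral. The pi from the half turn cancels the normalising 1 / pi, leaving
  the exponential distribution function.\<close>

lemma standard_complex_gaussian_norm_square_exponential:
  assumes Z: "circular_complex_gaussian M 1 Z"
    and [measurable]: "random_variable borel Z"
  shows "distributed M lborel (\<lambda>\<omega>. (cmod (Z \<omega>))\<^sup>2) (exponential_density 1)"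
proof (rule exponential_distributedI)
  fix a :: real
  assume a: "0 \<le> a"
  have "{\<omega> \<in> space M. (cmod (Z \<omega>))\<^sup>2 \<le> a} \<in> events" by measurable
  note nn_integral_indicator[OF this, symmetric]
  also have "(\<integral>\<^sup>+\<omega>. indicator {\<omega> \<in> space M. (cmod (Z \<omega>))\<^sup>2 \<le> a} \<omega> \<partial>M)
      = (\<integral>\<^sup>+\<omega>. indicator {..a} ((cmod (Z \<omega>))\<^sup>2) \<partial>M)"
    by (rule nn_integral_cong) (simp split: split_indicator)
  also have "\<dots> = ennreal (1 / pi) * (\<integral>\<^sup>+x. \<integral>\<^sup>+y. ennreal (exp (- (x\<^sup>2 + y\<^sup>2)))
      * indicator {..a} ((cmod (Complex x y))\<^sup>2) \<partial>lborel \<partial>lborel)"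
    by (intro nn_integral_standard_complex_gaussian Z) auto
  also have "\<dots> = ennreal (1 / pi) * (\<integral>\<^sup>+x. \<integral>\<^sup>+y. ennreal (exp (- (x\<^sup>2 + y\<^sup>2))
      * indicator {..a} (x\<^sup>2 + y\<^sup>2)) \<partial>lborel \<partial>lborel)"
    by (rule arg_cong[where f="(*) (ennreal (1 / pi))"], rule nn_integral_cong, rule nn_integral_cong)
      (simp add: cmod_power2 split: split_indicator)
  also have "\<dots> = ennreal (1 / pi) * (ennreal pi * (\<integral>\<^sup>+z. ennreal \<bar>z\<bar> * ennreal (exp (- z\<^sup>2) * indicator {..a} (z\<^sup>2)) \<partial>lborel))"
    by (subst nn_integral_radial_plane[where g="\<lambda>r. ennreal (exp (- r) * indicator {..a} r)"]) auto
  also have "\<dots> = ennreal (1 - exp (- a))"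
    unfolding nn_integral_truncated_gaussian_first_moment[OF a]
    using a by (simp add: ennreal_mult[symmetric])
  finally show "emeasure M {\<omega> \<in> space M. (cmod (Z \<omega>))\<^sup>2 \<le> a} = 1 - ennreal (exp (- a * 1))"
    by (simp add: ennreal_minus[symmetric])
qed auto

text \<open>The tool for integrating out one Gaussian while everything else is frozen in m and c.
  The coefficient c may vanish, which matters when it is a weight that can be zero or a multiple of
  a value of another Gaussian.\<close>

lemma standard_complex_gaussian_affine_laplace:
  fixes m c :: complex and a :: real
  assumes Z: "circular_complex_gaussian M 1 Z" and a: "0 \<le> a"
  shows "(\<integral>\<^sup>+\<omega>. ennreal (exp (- a * (cmod (m + c * Z \<omega>))\<^sup>2)) \<partial>M)
    = ennreal (exp (- a * (cmod m)\<^sup>2 / (1 + a * (cmod c)\<^sup>2)) / (1 + a * (cmod c)\<^sup>2))"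
proof -
  define A where "A = 1 + a * (cmod c)\<^sup>2"
  have A: "A > 0" using a by (auto simp: A_def add_pos_nonneg)
  \<comment> \<open>With w = cnj m * c and z = x + i y, the cross term of |m + c z|^2 is 2 * Re (w *
    z) = 2 * (x * Re w - y * Im w). So p and q are the linear coefficients, and the exponent splits
    into one quadratic in x and one in y, both with leading coefficient - A.\<close>
  define p where "p = a * Re (cnj m * c)"
  define q where "q = - a * Im (cnj m * c)"
  have pq: "p\<^sup>2 + q\<^sup>2 = a\<^sup>2 * ((cmod m)\<^sup>2 * (cmod c)\<^sup>2)"
    unfolding p_def q_def cmod_power2 by (simp add: power2_eq_square algebra_simps)
  have expand: "- (x\<^sup>2 + y\<^sup>2) - a * (cmod (m + c * Complex x y))\<^sup>2
      = - a * (cmod m)\<^sup>2 + (- A * x\<^sup>2 - 2 * p * x) + (- A * y\<^sup>2 - 2 * q * y)" for x y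
    unfolding p_def q_def A_def cmod_power2 by (simp add: power2_eq_square algebra_simps)
  have "(\<integral>\<^sup>+\<omega>. ennreal (exp (- a * (cmod (m + c * Z \<omega>))\<^sup>2)) \<partial>M)
      = ennreal (1 / pi) * (\<integral>\<^sup>+x. \<integral>\<^sup>+y. ennreal (exp (- (x\<^sup>2 + y\<^sup>2)))
          * ennreal (exp (- a * (cmod (m + c * Complex x y))\<^sup>2)) \<partial>lborel \<partial>lborel)"
    by (intro nn_integral_standard_complex_gaussian Z) auto
  also have "\<dots> = ennreal (1 / pi) * (\<integral>\<^sup>+x. \<integral>\<^sup>+y. ennreal (exp (- a * (cmod m)\<^sup>2))
      * (ennreal (exp (- A * x\<^sup>2 - 2 * p * x)) * ennreal (exp (- A * y\<^sup>2 - 2 * q * y))) \<partial>lborel \<partial>lborel)"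
  proof (rule arg_cong[where f="(*) (ennreal (1 / pi))"], rule nn_integral_cong, rule nn_integral_cong)
    fix x y
    have "exp (- (x\<^sup>2 + y\<^sup>2)) * exp (- a * (cmod (m + c * Complex x y))\<^sup>2)
        = exp (- (x\<^sup>2 + y\<^sup>2) - a * (cmod (m + c * Complex x y))\<^sup>2)"
      by (simp add: mult_exp_exp)
    also have "\<dots> = exp (- a * (cmod m)\<^sup>2) * (exp (- A * x\<^sup>2 - 2 * p * x) * exp (- A * y\<^sup>2 - 2 * q * y))"
      unfolding expand by (simp only: exp_add mult.assoc)
    finally show "ennreal (exp (- (x\<^sup>2 + y\<^sup>2))) * ennreal (exp (- a * (cmod (m + c * Complex x y))\<^sup>2))
        = ennreal (exp (- a * (cmod m)\<^sup>2))
          * (ennreal (exp (- A * x\<^sup>2 - 2 * p * x)) * ennreal (exp (- A * y\<^sup>2 - 2 * q * y)))"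
      by (simp only: ennreal_mult[symmetric] exp_ge_zero mult_nonneg_nonneg)
  qed
  also have "\<dots> = ennreal (1 / pi) * (ennreal (exp (- a * (cmod m)\<^sup>2))
      * ((\<integral>\<^sup>+x. ennreal (exp (- A * x\<^sup>2 - 2 * p * x)) \<partial>lborel)
       * (\<integral>\<^sup>+y. ennreal (exp (- A * y\<^sup>2 - 2 * q * y)) \<partial>lborel)))"
    by (simp add: nn_integral_cmult nn_integral_multc)
  also have "\<dots> = ennreal (1 / pi * (exp (- a * (cmod m)\<^sup>2)
      * ((sqrt (pi / A) * exp (p\<^sup>2 / A)) * (sqrt (pi / A) * exp (q\<^sup>2 / A)))))"
    unfolding nn_integral_gaussian_linear[OF A] using A by (simp add: ennreal_mult[symmetric])
  also have "1 / pi * (exp (- a * (cmod m)\<^sup>2)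
      * ((sqrt (pi / A) * exp (p\<^sup>2 / A)) * (sqrt (pi / A) * exp (q\<^sup>2 / A))))
      = 1 / pi * (sqrt (pi / A) * sqrt (pi / A)) * exp (- a * (cmod m)\<^sup>2 + (p\<^sup>2 + q\<^sup>2) / A)"
    by (simp only: exp_add add_divide_distrib mult_ac)
  also have "sqrt (pi / A) * sqrt (pi / A) = pi / A"
    using A by simp
  \<comment> \<open>As p^2 + q^2 = a^2 |m|^2 |c|^2, the left side is - a |m|^2 * (A - a |c|^2) / A,
    and A - a |c|^2 = 1.\<close>
  also have "- a * (cmod m)\<^sup>2 + (p\<^sup>2 + q\<^sup>2) / A = - a * (cmod m)\<^sup>2 / A"
    using A unfolding pq by (simp add: field_simps) (simp add: A_def power2_eq_square algebra_simps)
  finally show ?thesis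
    by (simp add: A_def)
qed

text \<open>The joint law is a product, so Tonelli applies. Writing the inner integral over M again,
  with a second sample point, lets the formulas for a single Gaussian on M be applied directly with
  X frozen.\<close>

lemma indep_var_nn_integral_iterated:
  assumes ind: "indep_var S X T Y" and f: "f \<in> borel_measurable (S \<Otimes>\<^sub>M T)"
  shows "(\<integral>\<^sup>+\<omega>. f (X \<omega>, Y \<omega>) \<partial>M) = (\<integral>\<^sup>+\<omega>. \<integral>\<^sup>+\<omega>'. f (X \<omega>, Y \<omega>') \<partial>M \<partial>M)"
proof -
  have X[measurable]: "random_variable S X" and Y[measurable]: "random_variable T Y"
    and eq: "distr M S X \<Otimes>\<^sub>M distr M T Y = distr M (S \<Otimes>\<^sub>M T) (\<lambda>x. (X x, Y x))"
    using ind unfolding indep_var_distribution_eq by auto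
  interpret Y: prob_space "distr M T Y" by (rule prob_space_distr) fact
  note f[measurable]
  have "(\<integral>\<^sup>+\<omega>. f (X \<omega>, Y \<omega>) \<partial>M) = (\<integral>\<^sup>+p. f p \<partial>(distr M S X \<Otimes>\<^sub>M distr M T Y))"
    unfolding eq by (subst nn_integral_distr) auto
  also have "\<dots> = (\<integral>\<^sup>+x. \<integral>\<^sup>+y. f (x, y) \<partial>distr M T Y \<partial>distr M S X)"
    by (subst Y.nn_integral_fst[symmetric]) auto
  also have "\<dots> = (\<integral>\<^sup>+x. \<integral>\<^sup>+\<omega>'. f (x, Y \<omega>') \<partial>M \<partial>distr M S X)"
    by (intro nn_integral_cong nn_integral_distr) auto
  also have "\<dots> = (\<integral>\<^sup>+\<omega>. \<integral>\<^sup>+\<omega>'. f (X \<omega>, Y \<omega>') \<partial>M \<partial>M)"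
    by (intro nn_integral_distr) auto
  finally show ?thesis .
qed

end

section \<open>Integrating out the variables of the channel\<close>

context sosf_channel
begin

text \<open>The phase is regarded as complex, since \<open>indep_vars\<close> needs a common range type.\<close>

lemma phase_gaussians_indep_vars:
  "indep_vars (\<lambda>_. borel) (\<lambda>i. [\<lambda>x. complex_of_real (\<phi> x), G1, G2, G3] ! i) {..<4}"
proof -
  note [measurable] = phase_measurable gauss_measurable
  let ?X = "\<lambda>i. [\<lambda>x. complex_of_real (\<phi> x), G1, G2, G3] ! i"
  have four: "i = 0 \<or> i = 1 \<or> i = 2 \<or> i = 3" if "i \<in> {..<4}" for i :: nat
    using that by auto
  have "indep_sets (\<lambda>i. {?X i -` A \<inter> space M |A. A \<in> sets borel}) {..<4}"
  proof (rule indep_sets_mono_sets[OF mutually_indep])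
    fix i :: nat
    assume i: "i \<in> {..<4}"
    \<comment> \<open>The embedding of the reals is Borel measurable, so every event of the
      complex-valued phase is already an event of \<phi>; independence passes to these smaller
      families.\<close>
    have sub: "{(\<lambda>x. complex_of_real (\<phi> x)) -` A \<inter> space M |A. A \<in> sets borel}
        \<subseteq> {\<phi> -` A \<inter> space M |A. A \<in> sets borel}"
    proof safe
      fix A :: "complex set"
      assume [measurable]: "A \<in> sets borel"
      have "complex_of_real -` A \<inter> space borel \<in> sets borel"
        by measurable
      then show "\<exists>B. (\<lambda>x. complex_of_real (\<phi> x)) -` A \<inter> space M = \<phi> -` B \<inter> space M \<and> B \<in> sets borel"
        by (intro exI[of _ "complex_of_real -` A"]) auto
    qed
    from four[OF i] show "{?X i -` A \<inter> space M |A. A \<in> sets borel}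
        \<subseteq> [sets (vimage_algebra (space M) \<phi> borel), sets (vimage_algebra (space M) G1 borel),
            sets (vimage_algebra (space M) G2 borel), sets (vimage_algebra (space M) G3 borel)] ! i"
      by (elim disjE) (use sub in \<open>simp_all add: sets_vimage_algebra2\<close>)
  qed
  moreover have "random_variable borel (?X i)" if "i \<in> {..<4}" for i
    using four[OF that] by auto
  ultimately show ?thesis
    unfolding indep_vars_def2 by simp
qed

text \<open>Index 0 is the phase and index i > 0 is Gi. The lemma is used with B = {1} to integrate
  over G1, and then with B = {2} to integrate over G2.\<close>

lemma nn_integral_phase_gaussians_iterated:
  assumes "A \<inter> B = {}" "A \<subseteq> {..<4}" "B \<subseteq> {..<4}"
    and "f \<in> borel_measurable (PiM A (\<lambda>_. borel) \<Otimes>\<^sub>M PiM B (\<lambda>_. borel))"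
  defines "X \<equiv> \<lambda>i. [\<lambda>x. complex_of_real (\<phi> x), G1, G2, G3] ! i"
  shows "(\<integral>\<^sup>+x. f (\<lambda>i\<in>A. X i x, \<lambda>i\<in>B. X i x) \<partial>M)
    = (\<integral>\<^sup>+x. \<integral>\<^sup>+x'. f (\<lambda>i\<in>A. X i x, \<lambda>i\<in>B. X i x') \<partial>M \<partial>M)"
  unfolding X_def
  by (rule indep_var_nn_integral_iterated[OF indep_var_restrict[OF phase_gaussians_indep_vars]]) fact+

lemma laplace_power_exponential_mixture:
  assumes k: "0 < k"
  shows "(\<integral>\<^sup>+x. ennreal (exp (- k * (cmod (sosf_signal \<omega>0 \<omega>1 \<omega>2 \<phi> G1 G2 G3 x))\<^sup>2)) \<partial>M)
    = (\<integral>\<^sup>+r. ennreal (exp (- r)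
        * (exp (- k * \<omega>0\<^sup>2 / (1 + k * \<omega>1\<^sup>2 + k * \<omega>2\<^sup>2 * r)) / (1 + k * \<omega>1\<^sup>2 + k * \<omega>2\<^sup>2 * r)))
        * indicator {0..} r \<partial>lborel)"
proof -
  note [measurable] = phase_measurable gauss_measurable
  define K where "K = 1 + k * \<omega>1\<^sup>2"
  have K: "K > 0" using k by (auto simp: K_def add_pos_nonneg)
  define m where "m = (\<lambda>p g2 g3. of_real \<omega>0 * exp (\<i> * p) + of_real \<omega>2 * g2 * g3 :: complex)"
  let ?p = "\<lambda>x. complex_of_real (\<phi> x)"
  define h where "h r = exp (- k * \<omega>0\<^sup>2 / (K + k * \<omega>2\<^sup>2 * r)) / (K + k * \<omega>2\<^sup>2 * r)" for r
  have [measurable]: "h \<in> borel_measurable borel" unfolding h_def by measurable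
  have "(\<integral>\<^sup>+x. ennreal (exp (- k * (cmod (sosf_signal \<omega>0 \<omega>1 \<omega>2 \<phi> G1 G2 G3 x))\<^sup>2)) \<partial>M)
      = (\<integral>\<^sup>+x. ennreal (exp (- k * (cmod (m (?p x) (G2 x) (G3 x) + of_real \<omega>1 * G1 x))\<^sup>2)) \<partial>M)"
    by (intro nn_integral_cong) (simp add: sosf_signal_def m_def algebra_simps)
  also have "\<dots> = (\<integral>\<^sup>+x. \<integral>\<^sup>+x'. ennreal (exp (- k *
      (cmod (m (?p x) (G2 x) (G3 x) + of_real \<omega>1 * G1 x'))\<^sup>2)) \<partial>M \<partial>M)"
    using nn_integral_phase_gaussians_iterated[of "{0, 2, 3}" "{1}"
      "\<lambda>(v, w). ennreal (exp (- k * (cmod (m (v 0) (v 2) (v 3) + of_real \<omega>1 * w 1))\<^sup>2))"]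
    by (simp add: m_def)
  \<comment> \<open>The affine formula with a = k and c = \<omega>1 gives the denominator K.\<close>
  also have "\<dots> = (\<integral>\<^sup>+x. ennreal (exp (- k * (cmod (m (?p x) (G2 x) (G3 x)))\<^sup>2 / K) / K) \<partial>M)"
    using k by (simp add: standard_complex_gaussian_affine_laplace[OF gauss(1), simplified] K_def)
  \<comment> \<open>What remains has the same shape with rate k / K. The product is reordered so
    that G2 is the Gaussian and \<omega>2 * G3 its frozen coefficient.\<close>
  also have "\<dots> = (\<integral>\<^sup>+x. ennreal (1 / K) * ennreal (exp (- (k / K) *
      (cmod (of_real \<omega>0 * exp (\<i> * ?p x) + of_real \<omega>2 * G3 x * G2 x))\<^sup>2)) \<partial>M)"
    using K by (intro nn_integral_cong) (simp add: m_def ennreal_mult[symmetric] algebra_simps)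
  also have "\<dots> = (\<integral>\<^sup>+x. \<integral>\<^sup>+x'. ennreal (1 / K) * ennreal (exp (- (k / K) *
      (cmod (of_real \<omega>0 * exp (\<i> * ?p x) + of_real \<omega>2 * G3 x * G2 x'))\<^sup>2)) \<partial>M \<partial>M)"
    using nn_integral_phase_gaussians_iterated[of "{0, 3}" "{2}"
      "\<lambda>(v, w). ennreal (1 / K) * ennreal (exp (- (k / K) *
        (cmod (of_real \<omega>0 * exp (\<i> * v 0) + of_real \<omega>2 * v 3 * w 2))\<^sup>2))"]
    by simp
  also have "\<dots> = (\<integral>\<^sup>+x. ennreal (1 / K) * ennreal (exp (- (k / K) * (cmod (of_real \<omega>0 * exp (\<i> * ?p x)))\<^sup>2
        / (1 + (k / K) * (cmod (of_real \<omega>2 * G3 x))\<^sup>2)) / (1 + (k / K) * (cmod (of_real \<omega>2 * G3 x))\<^sup>2)) \<partial>M)"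
  proof (rule nn_integral_cong)
    fix x
    have "0 \<le> k / K" using k K by simp
    from standard_complex_gaussian_affine_laplace[OF gauss(2) this, of "of_real \<omega>0 * exp (\<i> * ?p x)" "of_real \<omega>2 * G3 x"]
    show "(\<integral>\<^sup>+x'. ennreal (1 / K) * ennreal (exp (- (k / K) *
        (cmod (of_real \<omega>0 * exp (\<i> * ?p x) + of_real \<omega>2 * G3 x * G2 x'))\<^sup>2)) \<partial>M)
      = ennreal (1 / K) * ennreal (exp (- (k / K) * (cmod (of_real \<omega>0 * exp (\<i> * ?p x)))\<^sup>2
        / (1 + (k / K) * (cmod (of_real \<omega>2 * G3 x))\<^sup>2)) / (1 + (k / K) * (cmod (of_real \<omega>2 * G3 x))\<^sup>2))"
      by (subst nn_integral_cmult) auto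
  qed
  also have "\<dots> = (\<integral>\<^sup>+x. ennreal (h ((cmod (G3 x))\<^sup>2)) \<partial>M)"
  proof (rule nn_integral_cong)
    fix x
    define r where "r = (cmod (G3 x))\<^sup>2"
    have r: "r \<ge> 0" by (simp add: r_def)
    \<comment> \<open>D is the denominator from the second application of the affine formula.
      Multiplied by the K of the first, it gives the combined denominator in
      \<open>h\<close>.\<close>
    define D where "D = 1 + (k / K) * (\<omega>2\<^sup>2 * r)"
    have D: "D > 0" using k K r by (auto simp: D_def add_pos_nonneg)
    have KD: "K * D = K + k * \<omega>2\<^sup>2 * r" using K by (simp add: D_def field_simps)
    \<comment> \<open>The phase disappears here: \<phi> is real, so its exponential has modulus
      1.\<close>
    have n: "(cmod (of_real \<omega>0 * exp (\<i> * ?p x)))\<^sup>2 = \<omega>0\<^sup>2"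
      "(cmod (of_real \<omega>2 * G3 x))\<^sup>2 = \<omega>2\<^sup>2 * r"
      by (auto simp: norm_mult power_mult_distrib r_def)
    show "ennreal (1 / K) * ennreal (exp (- (k / K) * (cmod (of_real \<omega>0 * exp (\<i> * ?p x)))\<^sup>2
        / (1 + (k / K) * (cmod (of_real \<omega>2 * G3 x))\<^sup>2)) / (1 + (k / K) * (cmod (of_real \<omega>2 * G3 x))\<^sup>2))
        = ennreal (h ((cmod (G3 x))\<^sup>2))"
      unfolding n h_def r_def[symmetric] D_def[symmetric] KD[symmetric]
      using K D by (simp add: ennreal_mult[symmetric])
  qed
  also have "\<dots> = (\<integral>\<^sup>+r. ennreal (exponential_density 1 r) * ennreal (h r) \<partial>lborel)"
    by (rule distributed_nn_integral[symmetric, OF standard_complex_gaussian_norm_square_exponential[OF gauss(3) gauss_measurable(3)]]) auto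
  also have "\<dots> = (\<integral>\<^sup>+r. ennreal (exp (- r) * h r) * indicator {0..} r \<partial>lborel)"
    using k K by (intro nn_integral_cong)
      (auto simp: exponential_density_def ennreal_mult' split: split_indicator)
  finally show ?thesis
    by (simp add: h_def K_def)
qed

text \<open>Put r = t - c in the exponential mixture. By the choice of c the denominator becomes k *
  \<omega>2^2 * t, the weight exp (- r) becomes exp c * exp (- t), and k * \<omega>0^2 over the
  denominator becomes (\<omega>0^2 / \<omega>2^2) / t. The range r \<ge> 0 becomes t \<ge>
  c.\<close>

lemma laplace_power:
  assumes k: "0 < k" and \<omega>2: "\<omega>2 > 0"
  defines "c \<equiv> (1 + k * \<omega>1\<^sup>2) / (k * \<omega>2\<^sup>2)"
  shows "(\<integral>x. exp (- k * (cmod (sosf_signal \<omega>0 \<omega>1 \<omega>2 \<phi> G1 G2 G3 x))\<^sup>2) \<partial>M)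
    = exp c / (k * \<omega>2\<^sup>2) * gen_inc_Gamma 0 c (\<omega>0\<^sup>2 / \<omega>2\<^sup>2)"
proof -
  note [measurable] = phase_measurable gauss_measurable
  have [measurable]: "(\<lambda>x. sosf_signal \<omega>0 \<omega>1 \<omega>2 \<phi> G1 G2 G3 x) \<in> borel_measurable M"
    unfolding sosf_signal_def by measurable
  define B where "B = k * \<omega>2\<^sup>2"
  have B: "B > 0" using k \<omega>2 by (simp add: B_def)
  have c: "c > 0" using k \<omega>2 by (auto simp: c_def intro!: divide_pos_pos add_pos_nonneg)
  have Bc: "1 + k * \<omega>1\<^sup>2 = B * c" using k \<omega>2 by (simp add: B_def c_def)
  have quot: "k * \<omega>0\<^sup>2 / (B * t) = (\<omega>0\<^sup>2 / \<omega>2\<^sup>2) / t" for t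
    using k by (simp add: B_def)
  \<comment> \<open>The integrand of \<open>gen_inc_Gamma\<close> with first argument 0, written so
    that the definition folds to it literally.\<close>
  define g where "g t = t powr (0 - 1) * exp (- t) * exp (- (\<omega>0\<^sup>2 / \<omega>2\<^sup>2) / t)" for t :: real
  have [measurable]: "g \<in> borel_measurable borel" unfolding g_def by measurable
  have "(\<integral>\<^sup>+x. ennreal (exp (- k * (cmod (sosf_signal \<omega>0 \<omega>1 \<omega>2 \<phi> G1 G2 G3 x))\<^sup>2)) \<partial>M)
    = (\<integral>\<^sup>+r. ennreal (exp (- r)
        * (exp (- k * \<omega>0\<^sup>2 / (1 + k * \<omega>1\<^sup>2 + B * r)) / (1 + k * \<omega>1\<^sup>2 + B * r)))
        * indicator {0..} r \<partial>lborel)"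
    unfolding B_def by (rule laplace_power_exponential_mixture[OF k])
  also have "\<dots> = (\<integral>\<^sup>+t. ennreal (exp (- (- c + t))
        * (exp (- k * \<omega>0\<^sup>2 / (1 + k * \<omega>1\<^sup>2 + B * (- c + t))) / (1 + k * \<omega>1\<^sup>2 + B * (- c + t))))
        * indicator {0..} (- c + t) \<partial>lborel)"
    by (subst nn_integral_real_affine[where c=1 and t="- c"]) auto
  also have "\<dots> = (\<integral>\<^sup>+t. ennreal (exp c / B) * ennreal (indicator {c..} t * g t) \<partial>lborel)"
  proof (rule nn_integral_cong)
    fix t :: real
    have "exp (- (- c + t)) * (exp (- k * \<omega>0\<^sup>2 / (1 + k * \<omega>1\<^sup>2 + B * (- c + t))) / (1 + k * \<omega>1\<^sup>2 + B * (- c + t)))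
        = exp c / B * g t" if "c \<le> t"
    proof -
      have t: "t > 0" using that c by simp
      have "1 + k * \<omega>1\<^sup>2 + B * (- c + t) = B * t" by (simp add: Bc algebra_simps)
      moreover have "exp (- (- c + t)) = exp c * exp (- t)" by (simp add: mult_exp_exp)
      moreover have "- k * \<omega>0\<^sup>2 / (B * t) = - (\<omega>0\<^sup>2 / \<omega>2\<^sup>2) / t" using quot[of t] by simp
      moreover have "t powr (0 - 1) = 1 / t" using t by (simp add: powr_minus divide_simps)
      moreover have "u * v * (w / (B * t)) = u / B * (1 / t * v * w)" for u v w :: real by simp
      ultimately show ?thesis by (simp only: g_def)
    qed
    then show "ennreal (exp (- (- c + t))
        * (exp (- k * \<omega>0\<^sup>2 / (1 + k * \<omega>1\<^sup>2 + B * (- c + t))) / (1 + k * \<omega>1\<^sup>2 + B * (- c + t))))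
        * indicator {0..} (- c + t) = ennreal (exp c / B) * ennreal (indicator {c..} t * g t)"
      using B by (auto simp: ennreal_mult[symmetric] g_def split: split_indicator)
  qed
  also have "\<dots> = ennreal (exp c / B) * (\<integral>\<^sup>+t. ennreal (indicator {c..} t * g t) \<partial>lborel)"
    by (rule nn_integral_cmult) auto
  finally have *: "(\<integral>\<^sup>+x. ennreal (exp (- k * (cmod (sosf_signal \<omega>0 \<omega>1 \<omega>2 \<phi> G1 G2 G3 x))\<^sup>2)) \<partial>M)
      = ennreal (exp c / B) * (\<integral>\<^sup>+t. ennreal (indicator {c..} t * g t) \<partial>lborel)" .
  \<comment> \<open>For nonnegative measurable functions the Bochner integral is
    \<open>enn2real\<close> of the nonnegative one, also when the latter is infinite, since both
    sides are then 0. Hence the identity transfers without a separate proof of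
    integrability.\<close>
  have "(\<integral>x. exp (- k * (cmod (sosf_signal \<omega>0 \<omega>1 \<omega>2 \<phi> G1 G2 G3 x))\<^sup>2) \<partial>M)
      = exp c / B * enn2real (\<integral>\<^sup>+t. ennreal (indicator {c..} t * g t) \<partial>lborel)"
    using B by (subst integral_eq_nn_integral) (auto simp: * [simplified] enn2real_mult)
  also have "enn2real (\<integral>\<^sup>+t. ennreal (indicator {c..} t * g t) \<partial>lborel) = gen_inc_Gamma 0 c (\<omega>0\<^sup>2 / \<omega>2\<^sup>2)"
    unfolding gen_inc_Gamma_def set_lebesgue_integral_def real_scaleR_def g_def[symmetric]
    by (rule integral_eq_nn_integral[symmetric]) (auto simp: g_def)
  finally show ?thesis by (simp add: B_def)
qed

end

section \<open>Specialisation to the three cases\<close>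

lemma gen_inc_Gamma_0_0:
  assumes "0 < x"
  shows "gen_inc_Gamma 0 x 0 = exp_integral_E1 x"
  unfolding gen_inc_Gamma_def exp_integral_E1_def
  using assms by (intro set_lebesgue_integral_cong) (auto simp: powr_minus divide_simps)

theorem mainTheorem10:
  fixes M :: "'a measure"
    and \<omega>0 \<omega>1 \<omega>2 \<alpha> \<beta> gbar s :: real
    and \<phi> :: "'a \<Rightarrow> real"
    and G1 G2 G3 :: "'a \<Rightarrow> complex"
    and \<gamma> :: "'a \<Rightarrow> real"
  assumes channel: "sosf_channel M \<omega>0 \<omega>1 \<omega>2 \<phi> G1 G2 G3"
    and alpha: "\<alpha> = \<omega>2\<^sup>2"
    and beta: "\<beta> = \<omega>0\<^sup>2"
    and gbar_pos: "gbar > 0"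
    and snr: "\<gamma> = inst_snr gbar (sosf_signal \<omega>0 \<omega>1 \<omega>2 \<phi> G1 G2 G3)"
    and s_neg: "s < 0"
  shows "(0 < \<alpha> \<and> \<alpha> \<le> 1 \<and> \<beta> = 1 - \<alpha> \<longrightarrow>
           mgf M \<gamma> s = - (exp (- (1 / (s * gbar * \<alpha>))) / (s * gbar * \<alpha>))
             * gen_inc_Gamma 0 (- 1 / (s * \<alpha> * gbar)) ((1 - \<alpha>) / \<alpha>))
       \<and> (0 < \<alpha> \<and> \<alpha> \<le> 1 \<and> \<beta> = 0 \<longrightarrow>
           mgf M \<gamma> s = - (1 / (s * gbar * \<alpha>))
             * exp ((s * gbar * (1 - \<alpha>) - 1) / (s * gbar * \<alpha>))
             * exp_integral_E1 ((s * (1 - \<alpha>) * gbar - 1) / (s * gbar * \<alpha>)))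
       \<and> (\<alpha> = 1 \<and> \<beta> = 0 \<longrightarrow>
           mgf M \<gamma> s = - (exp (- (1 / (s * gbar))) / (s * gbar))
             * exp_integral_E1 (- 1 / (s * gbar)))"
proof -
  interpret sosf_channel M \<omega>0 \<omega>1 \<omega>2 \<phi> G1 G2 G3 by (rule channel)
  \<comment> \<open>The moment generating function at s < 0 is the Laplace transform of |S|^2 at
    this positive k.\<close>
  define k where "k = - (s * gbar)"
  have k: "k > 0" using s_neg gbar_pos by (simp add: k_def mult_neg_pos)
  have sg: "s * gbar = - k" by (simp add: k_def)
  have mgf: "mgf M \<gamma> s
      = exp ((1 + k * (1 - \<alpha> - \<beta>)) / (k * \<alpha>)) / (k * \<alpha>)
        * gen_inc_Gamma 0 ((1 + k * (1 - \<alpha> - \<beta>)) / (k * \<alpha>)) (\<beta> / \<alpha>)" if "\<alpha> > 0"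
  proof -
    have \<omega>2: "\<omega>2 > 0"
      using that weights_nonneg(3) by (auto simp: alpha less_le)
    have \<omega>1: "\<omega>1\<^sup>2 = 1 - \<alpha> - \<beta>"
      using weights_normalized by (simp add: alpha beta)
    have "mgf M \<gamma> s = (\<integral>x. exp (- k * (cmod (sosf_signal \<omega>0 \<omega>1 \<omega>2 \<phi> G1 G2 G3 x))\<^sup>2) \<partial>M)"
      by (simp add: mgf_def snr inst_snr_def k_def mult.assoc)
    also note laplace_power[OF k \<omega>2]
    finally show ?thesis by (simp add: \<omega>1 alpha beta)
  qed
  \<comment> \<open>At \<beta> = 0 the incomplete gamma function reduces to E1. Its argument is
    positive because \<alpha> \<le> 1.\<close>
  have E1: "mgf M \<gamma> s = exp ((1 + k * (1 - \<alpha>)) / (k * \<alpha>)) / (k * \<alpha>)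
      * exp_integral_E1 ((1 + k * (1 - \<alpha>)) / (k * \<alpha>))" if "0 < \<alpha>" "\<alpha> \<le> 1" "\<beta> = 0"
    using mgf that k by (simp add: gen_inc_Gamma_0_0 add_pos_nonneg)
  \<comment> \<open>Here \<beta> = 1 - \<alpha> forces \<omega>1 = 0, so the lower limit is 1 / (k *
    \<alpha>); the rest is rewriting - k as s * gbar.\<close>
  have i: "mgf M \<gamma> s = - (exp (- (1 / (s * gbar * \<alpha>))) / (s * gbar * \<alpha>))
      * gen_inc_Gamma 0 (- 1 / (s * \<alpha> * gbar)) ((1 - \<alpha>) / \<alpha>)"
    if "0 < \<alpha>" "\<alpha> \<le> 1" "\<beta> = 1 - \<alpha>"
  proof -
    have "s * \<alpha> * gbar = - (k * \<alpha>)" by (simp add: k_def)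
    then show ?thesis using mgf that by (simp add: sg)
  qed
  have ii: "mgf M \<gamma> s = - (1 / (s * gbar * \<alpha>))
      * exp ((s * gbar * (1 - \<alpha>) - 1) / (s * gbar * \<alpha>))
      * exp_integral_E1 ((s * (1 - \<alpha>) * gbar - 1) / (s * gbar * \<alpha>))"
    if "0 < \<alpha>" "\<alpha> \<le> 1" "\<beta> = 0"
  proof -
    have "s * (1 - \<alpha>) * gbar = s * gbar * (1 - \<alpha>)" by simp
    moreover have "(- k * (1 - \<alpha>) - 1) / (- k * \<alpha>) = (1 + k * (1 - \<alpha>)) / (k * \<alpha>)"
      using k that by (simp add: field_simps)
    ultimately show ?thesis using E1[OF that] by (simp only: sg) simp
  qed
  have iii: "mgf M \<gamma> s = - (exp (- (1 / (s * gbar))) / (s * gbar)) * exp_integral_E1 (- 1 / (s * gbar))"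
    if "\<alpha> = 1" "\<beta> = 0"
    using E1 that by (simp add: sg)
  show ?thesis using i ii iii by blast
qed

end
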